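(* Let $R=\mathbb F_{q_1}\times\mathbb F_{q_2}\times\mathbb F_{q_3}$ be a product of three finite fields of orders $q_1,q_2,q_3$. Then $\omega(\mathcal D(R))=\max(q_1,q_2,q_3)+1$.
   Context: $Z(R)$ is the set of zero-divisors of $R$ and $Z(R)^*=Z(R)\setminus\{0\}$. $\Gamma(R)$ is the simple graph with vertex set $Z(R)^*$, with distinct $x,y$ adjacent iff $xy=0$. $W\Gamma(R)$ is the simple graph with vertex set $Z(R)^*$, with distinct $x,y$ adjacent iff there exist nonzero $r\in\operatorname{Ann}(x)$ and nonzero $s\in\operatorname{Ann}(y)$ with $rs=0$. The weak zero-divisor difference graph $\mathcal D(R)$ is the graph on $Z(R)^*$ with edge set $E(W\Gamma(R))\setminus E(\Gamma(R))$, with resulting isolated vertices deleted. $\omega(G)$ is the clique number, the maximum size of a clique in $G$. *)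

theory Defs
  imports "HOL-Algebra.Chinese_Remainder" "HOL-Library.Ramsey"
begin

text \<open>
  A simple graph is given by its vertex set and its edge set, an edge being a
  two-element set of vertices. This is the convention of \<^const>\<open>clique\<close> in
  \<^theory>\<open>HOL-Library.Ramsey\<close>. The rings are meant to be commutative with one.
\<close>

definition zero_divisors :: "('a, 'm) ring_scheme \<Rightarrow> 'a set" where
  "zero_divisors R =
     {x \<in> carrier R. \<exists>y \<in> carrier R. y \<noteq> \<zero>\<^bsub>R\<^esub> \<and> x \<otimes>\<^bsub>R\<^esub> y = \<zero>\<^bsub>R\<^esub>}"

definition nonzero_zero_divisors :: "('a, 'm) ring_scheme \<Rightarrow> 'a set" where
  "nonzero_zero_divisors R = zero_divisors R - {\<zero>\<^bsub>R\<^esub>}"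

definition annihilator :: "('a, 'm) ring_scheme \<Rightarrow> 'a \<Rightarrow> 'a set" where
  "annihilator R x = {r \<in> carrier R. r \<otimes>\<^bsub>R\<^esub> x = \<zero>\<^bsub>R\<^esub>}"

definition zero_divisor_graph_edges :: "('a, 'm) ring_scheme \<Rightarrow> 'a set set" where
  "zero_divisor_graph_edges R =
     {{x, y} | x y. x \<in> nonzero_zero_divisors R \<and> y \<in> nonzero_zero_divisors R \<and> x \<noteq> y \<and>
        x \<otimes>\<^bsub>R\<^esub> y = \<zero>\<^bsub>R\<^esub>}"

definition weak_zero_divisor_graph_edges :: "('a, 'm) ring_scheme \<Rightarrow> 'a set set" where
  "weak_zero_divisor_graph_edges R =
     {{x, y} | x y. x \<in> nonzero_zero_divisors R \<and> y \<in> nonzero_zero_divisors R \<and> x \<noteq> y \<and>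
        (\<exists>r \<in> annihilator R x. \<exists>s \<in> annihilator R y.
           r \<noteq> \<zero>\<^bsub>R\<^esub> \<and> s \<noteq> \<zero>\<^bsub>R\<^esub> \<and> r \<otimes>\<^bsub>R\<^esub> s = \<zero>\<^bsub>R\<^esub>)}"

definition difference_graph_edges :: "('a, 'm) ring_scheme \<Rightarrow> 'a set set" where
  "difference_graph_edges R = weak_zero_divisor_graph_edges R - zero_divisor_graph_edges R"

text \<open>Vertices on no edge of the difference are deleted.\<close>

definition difference_graph_verts :: "('a, 'm) ring_scheme \<Rightarrow> 'a set" where
  "difference_graph_verts R =
     {x \<in> nonzero_zero_divisors R. \<exists>e \<in> difference_graph_edges R. x \<in> e}"

text \<open>Only meaningful for finite \<open>V\<close>, where the maximum is over a finite nonempty set.\<close>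

definition clique_number :: "'a set \<Rightarrow> 'a set set \<Rightarrow> nat" where
  "clique_number V E = Max {card C | C. C \<subseteq> V \<and> clique C E}"

end

theory Submission
  imports Defs
begin

text \<open>
  In a product of fields everything is decided by supports: \<open>x y = 0\<close> iff the supports are
  disjoint, and \<open>Ann(x)\<close> consists of the elements supported off \<open>supp x\<close>. Hence distinct
  nonzero zero-divisors are adjacent in the difference graph iff their supports meet and are not
  one and the same maximal proper support. With three factors, a clique thus contains at most one
  element of each two-element support, so at most three elements if no singleton support occurs.
  If \<open>{i}\<close> occurs, the other supports contain \<open>i\<close>, hence are \<open>{i,j}\<close> and \<open>{i,k}\<close>, and there are
  at most \<open>(q\<^sub>i - 1) + 2\<close> elements; this bound is attained.
\<close>

section \<open>Zero-divisors and annihilators in terms of supports\<close>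

locale ring_with_supports =
  fixes R :: "('r, 'm) ring_scheme" and I :: "'i set" and supp :: "'r \<Rightarrow> 'i set"
  assumes supp_subset: "x \<in> carrier R \<Longrightarrow> supp x \<subseteq> I"
    and eq_zero_iff: "x \<in> carrier R \<Longrightarrow> x = \<zero>\<^bsub>R\<^esub> \<longleftrightarrow> supp x = {}"
    and mult_eq_zero_iff:
      "x \<in> carrier R \<Longrightarrow> y \<in> carrier R \<Longrightarrow> x \<otimes>\<^bsub>R\<^esub> y = \<zero>\<^bsub>R\<^esub> \<longleftrightarrow> supp x \<inter> supp y = {}"
    and supp_onto: "A \<subseteq> I \<Longrightarrow> \<exists>x \<in> carrier R. supp x = A"
begin

text \<open>An element killed by \<open>x\<close> lives off \<open>supp x\<close>, so a nonzero one
  exists exactly when \<open>supp x\<close> leaves room in \<open>I\<close>; an element with the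
  complementary support is a witness.\<close>

lemma nonzero_zero_divisors_iff:
  "x \<in> nonzero_zero_divisors R \<longleftrightarrow> x \<in> carrier R \<and> supp x \<noteq> {} \<and> supp x \<noteq> I"
proof -
  have "(\<exists>y \<in> carrier R. y \<noteq> \<zero>\<^bsub>R\<^esub> \<and> x \<otimes>\<^bsub>R\<^esub> y = \<zero>\<^bsub>R\<^esub>) \<longleftrightarrow> supp x \<noteq> I" if x: "x \<in> carrier R"
  proof
    assume "\<exists>y \<in> carrier R. y \<noteq> \<zero>\<^bsub>R\<^esub> \<and> x \<otimes>\<^bsub>R\<^esub> y = \<zero>\<^bsub>R\<^esub>"
    then obtain y where "y \<in> carrier R" "supp y \<noteq> {}" "supp x \<inter> supp y = {}"
      using x eq_zero_iff mult_eq_zero_iff by blast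
    then show "supp x \<noteq> I" using supp_subset by blast
  next
    assume "supp x \<noteq> I"
    obtain y where "y \<in> carrier R" "supp y = I - supp x"
      using supp_onto[of "I - supp x"] by blast
    with \<open>supp x \<noteq> I\<close> show "\<exists>y \<in> carrier R. y \<noteq> \<zero>\<^bsub>R\<^esub> \<and> x \<otimes>\<^bsub>R\<^esub> y = \<zero>\<^bsub>R\<^esub>"
      using x supp_subset[OF x] eq_zero_iff mult_eq_zero_iff by blast
  qed
  then show ?thesis
    using eq_zero_iff by (auto simp: nonzero_zero_divisors_def zero_divisors_def)
qed

text \<open>The pair \<open>r\<close>, \<open>s\<close> exists iff distinct indices can be chosen in
  the complements of \<open>supp x\<close> and \<open>supp y\<close>. Both complements are nonempty,
  so the choice fails only if they are one and the same singleton.\<close>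

lemma weak_adjacent_iff:
  assumes "x \<in> nonzero_zero_divisors R" "y \<in> nonzero_zero_divisors R"
  shows "(\<exists>r \<in> annihilator R x. \<exists>s \<in> annihilator R y.
            r \<noteq> \<zero>\<^bsub>R\<^esub> \<and> s \<noteq> \<zero>\<^bsub>R\<^esub> \<and> r \<otimes>\<^bsub>R\<^esub> s = \<zero>\<^bsub>R\<^esub>)
         \<longleftrightarrow> \<not> (supp x = supp y \<and> is_singleton (I - supp x))"
    (is "?weak \<longleftrightarrow> _")
proof -
  have x: "x \<in> carrier R" "supp x \<subseteq> I" "supp x \<noteq> I"
    and y: "y \<in> carrier R" "supp y \<subseteq> I" "supp y \<noteq> I"
    using assms supp_subset by (auto simp: nonzero_zero_divisors_iff)
  have mem_ann: "r \<in> annihilator R z \<longleftrightarrow> r \<in> carrier R \<and> supp r \<inter> supp z = {}"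
    if "z \<in> carrier R" for r z
    using that mult_eq_zero_iff by (auto simp: annihilator_def)
  show ?thesis
  proof
    assume ?weak
    then obtain r s where "r \<in> carrier R" "supp r \<inter> supp x = {}" "supp r \<noteq> {}"
      "s \<in> carrier R" "supp s \<inter> supp y = {}" "supp s \<noteq> {}" "supp r \<inter> supp s = {}"
      using mem_ann[OF x(1)] mem_ann[OF y(1)] eq_zero_iff mult_eq_zero_iff by meson
    moreover from this have "supp r \<subseteq> I - supp x" "supp s \<subseteq> I - supp y"
      using supp_subset by blast+
    \<comment> \<open>If both complements were one singleton, \<open>r\<close> and \<open>s\<close>
      would both have it as support, although their supports are disjoint.\<close>
    ultimately show "\<not> (supp x = supp y \<and> is_singleton (I - supp x))"
      unfolding is_singleton_def by (metis disjoint_iff subset_singletonD inf.idem)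
  next
    assume *: "\<not> (supp x = supp y \<and> is_singleton (I - supp x))"
    have "\<exists>i \<in> I - supp x. \<exists>j \<in> I - supp y. i \<noteq> j"
    proof (rule ccontr)
      assume "\<not> ?thesis"
      then have eq: "i = j" if "i \<in> I - supp x" "j \<in> I - supp y" for i j
        using that by blast
      obtain a b where ab: "a \<in> I - supp x" "b \<in> I - supp y" using x y by blast
      have "I - supp x = {b}" "I - supp y = {a}" "a = b" using eq ab by blast+
      then have "supp x = supp y" "is_singleton (I - supp x)"
        using x(2) y(2) by (blast, simp)
      with * show False by blast
    qed
    then obtain i j where ij: "i \<in> I - supp x" "j \<in> I - supp y" "i \<noteq> j" by blast
    obtain r where r: "r \<in> carrier R" "supp r = {i}" using supp_onto[of "{i}"] ij by auto
    obtain s where s: "s \<in> carrier R" "supp s = {j}" using supp_onto[of "{j}"] ij by auto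
    have "r \<in> annihilator R x" "s \<in> annihilator R y"
      using r s ij mem_ann x(1) y(1) by auto
    moreover have "r \<noteq> \<zero>\<^bsub>R\<^esub>" "s \<noteq> \<zero>\<^bsub>R\<^esub>" "r \<otimes>\<^bsub>R\<^esub> s = \<zero>\<^bsub>R\<^esub>"
      using r s ij eq_zero_iff mult_eq_zero_iff by auto
    ultimately show ?weak by blast
  qed
qed

section \<open>Edges of the graphs in terms of supports\<close>

lemma zero_divisor_graph_edge_iff:
  "{x, y} \<in> zero_divisor_graph_edges R \<longleftrightarrow>
     x \<in> nonzero_zero_divisors R \<and> y \<in> nonzero_zero_divisors R \<and> x \<noteq> y \<and>
     supp x \<inter> supp y = {}"
proof -
  have "{x, y} \<in> zero_divisor_graph_edges R \<longleftrightarrow>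
    (\<exists>u v. {x, y} = {u, v} \<and> u \<in> nonzero_zero_divisors R \<and> v \<in> nonzero_zero_divisors R \<and>
       u \<noteq> v \<and> supp u \<inter> supp v = {})"
    unfolding zero_divisor_graph_edges_def mem_Collect_eq
    using mult_eq_zero_iff nonzero_zero_divisors_iff by meson
  also have "\<dots> \<longleftrightarrow> x \<in> nonzero_zero_divisors R \<and> y \<in> nonzero_zero_divisors R \<and> x \<noteq> y \<and>
     supp x \<inter> supp y = {}"
    unfolding doubleton_eq_iff by blast
  finally show ?thesis .
qed

text \<open>An edge may be presented in either order of its ends. The condition mentions only
  \<open>supp x\<close>, yet it is symmetric because it is coupled with
  \<open>supp x = supp y\<close>.\<close>

lemma weak_zero_divisor_graph_edge_iff:
  "{x, y} \<in> weak_zero_divisor_graph_edges R \<longleftrightarrow>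
     x \<in> nonzero_zero_divisors R \<and> y \<in> nonzero_zero_divisors R \<and> x \<noteq> y \<and>
     \<not> (supp x = supp y \<and> is_singleton (I - supp x))"
proof -
  have "{x, y} \<in> weak_zero_divisor_graph_edges R \<longleftrightarrow>
    (\<exists>u v. {x, y} = {u, v} \<and> u \<in> nonzero_zero_divisors R \<and> v \<in> nonzero_zero_divisors R \<and>
       u \<noteq> v \<and> \<not> (supp u = supp v \<and> is_singleton (I - supp u)))"
    unfolding weak_zero_divisor_graph_edges_def mem_Collect_eq
    by (simp only: weak_adjacent_iff cong: conj_cong)
  also have "\<dots> \<longleftrightarrow> x \<in> nonzero_zero_divisors R \<and> y \<in> nonzero_zero_divisors R \<and> x \<noteq> y \<and>
     \<not> (supp x = supp y \<and> is_singleton (I - supp x))"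
    unfolding doubleton_eq_iff by metis
  finally show ?thesis .
qed

lemma difference_graph_edge_iff:
  "{x, y} \<in> difference_graph_edges R \<longleftrightarrow>
     x \<in> nonzero_zero_divisors R \<and> y \<in> nonzero_zero_divisors R \<and> x \<noteq> y \<and>
     supp x \<inter> supp y \<noteq> {} \<and> \<not> (supp x = supp y \<and> is_singleton (I - supp x))"
  by (auto simp: difference_graph_edges_def weak_zero_divisor_graph_edge_iff
      zero_divisor_graph_edge_iff)

text \<open>Deleting isolated vertices destroys no clique with at least two elements: each member
  has a neighbour in the clique.\<close>

lemma clique_subset_difference_graph_verts:
  assumes "clique C (difference_graph_edges R)" "2 \<le> card C"
  shows "C \<subseteq> difference_graph_verts R"
proof
  fix x assume "x \<in> C"
  have "\<not> C \<subseteq> {x}"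
    using card_mono[of "{x}" C] assms(2) by auto
  then obtain y where "y \<in> C" "y \<noteq> x" by blast
  then have "{x, y} \<in> difference_graph_edges R"
    using assms(1) \<open>x \<in> C\<close> by (auto simp: clique_def)
  then show "x \<in> difference_graph_verts R"
    unfolding difference_graph_verts_def using difference_graph_edge_iff by blast
qed

section \<open>The clique number for three indices\<close>

lemma clique_number_three:
  assumes fin: "finite (carrier R)" and I3: "card I = 3"
  shows "clique_number (difference_graph_verts R) (difference_graph_edges R)
           = Max ((\<lambda>i. card {x \<in> carrier R. supp x = {i}}) ` I) + 2"
proof -
  define L where "L i = {x \<in> carrier R. supp x = {i}}" for i
  define M where "M = Max ((\<lambda>i. card (L i)) ` I)"
  define E where "E = difference_graph_edges R"
  define V where "V = difference_graph_verts R"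
  have finI: "finite I" and neI: "I \<noteq> {}" using I3 by (auto intro: card_ge_0_finite)
  have finL: "finite (L i)" for i using fin by (simp add: L_def)
  have leM: "card (L i) \<le> M" if "i \<in> I" for i
    unfolding M_def using that finI by (intro Max_ge) auto
  have Lpos: "0 < card (L i)" if "i \<in> I" for i
    using supp_onto[of "{i}"] that finL[of i] by (auto simp: card_gt_0_iff L_def)
  have Vsub: "V \<subseteq> nonzero_zero_divisors R"
    by (auto simp: V_def difference_graph_verts_def)
  have finV: "finite V"
    by (rule finite_subset[OF _ fin]) (use Vsub nonzero_zero_divisors_iff in blast)
  \<comment> \<open>This turns the exceptional pairs into those that share a two-element support,
    the form in which cliques are counted.\<close>
  have singleton_compl: "is_singleton (I - A) \<longleftrightarrow> card A = 2" if "A \<subseteq> I" for A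
    using that I3 finI card_mono[OF finI that]
    by (auto simp: is_singleton_altdef card_Diff_subset finite_subset)
  have edge: "{x, y} \<in> E \<longleftrightarrow> x \<in> nonzero_zero_divisors R \<and> y \<in> nonzero_zero_divisors R \<and>
      x \<noteq> y \<and> supp x \<inter> supp y \<noteq> {} \<and> \<not> (supp x = supp y \<and> card (supp x) = 2)" for x y
    unfolding E_def difference_graph_edge_iff
    using singleton_compl supp_subset nonzero_zero_divisors_iff by meson
  have upper: "card C \<le> M + 2" if C: "C \<subseteq> V" "clique C E" for C
  proof -
    have finC: "finite C" using C(1) finV by (rule finite_subset)
    have Ccar: "x \<in> carrier R" "supp x \<subseteq> I" "supp x \<noteq> {}" "supp x \<noteq> I" if "x \<in> C" for x
      using that C(1) Vsub nonzero_zero_divisors_iff supp_subset by blast+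
    have card_supp: "card (supp x) = 1 \<or> card (supp x) = 2" if "x \<in> C" for x
    proof -
      have "supp x \<subset> I" "supp x \<noteq> {}" using Ccar[OF that] by auto
      moreover from this have "finite (supp x)" using finI finite_subset by blast
      ultimately have "card (supp x) < 3" "card (supp x) > 0"
        using psubset_card_mono[OF finI, of "supp x"] I3 by (simp_all add: card_gt_0_iff)
      then show ?thesis by linarith
    qed
    define D where "D = {x \<in> C. card (supp x) = 2}"
    have CE: "{x, y} \<in> E" if "x \<in> C" "y \<in> C" "x \<noteq> y" for x y
      using C(2) that by (auto simp: clique_def)
    \<comment> \<open>Two distinct members of \<open>D\<close> with equal supports would be an
      exceptional pair, hence not adjacent.\<close>
    have inj: "inj_on supp D"
      by (rule inj_onI) (use CE edge in \<open>unfold D_def, blast\<close>)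
    show ?thesis
    proof (cases "\<exists>x \<in> C. card (supp x) = 1")
      case True
      then obtain z i where z: "z \<in> C" "supp z = {i}" by (auto simp: card_1_singleton_iff)
      have iI: "i \<in> I" using Ccar[OF z(1)] z(2) by auto
      \<comment> \<open>Every other member is adjacent to \<open>z\<close>, so its support meets
        \<open>{i}\<close>.\<close>
      have all_i: "i \<in> supp x" if "x \<in> C" for x
        using CE[OF z(1) that] edge[of z x] z(2) by (cases "x = z") auto
      have "supp ` D \<subseteq> (\<lambda>j. {i, j}) ` (I - {i})"
      proof
        fix A assume "A \<in> supp ` D"
        then have A: "card A = 2" "i \<in> A" "A \<subseteq> I" using all_i Ccar by (auto simp: D_def)
        then obtain j where "A = {i, j}" "j \<noteq> i" by (auto simp: card_2_iff)
        with A show "A \<in> (\<lambda>j. {i, j}) ` (I - {i})" by auto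
      qed
      then have "card (supp ` D) \<le> card ((\<lambda>j. {i, j}) ` (I - {i}))"
        using finI by (intro card_mono) auto
      also have "\<dots> \<le> card (I - {i})" using finI by (intro card_image_le) auto
      also have "\<dots> = 2" using I3 iI by simp
      finally have "card D \<le> 2" using card_image[OF inj] by simp
      \<comment> \<open>A member outside \<open>D\<close> has a singleton support, which contains
        \<open>i\<close> and so equals \<open>{i}\<close>.\<close>
      have "C \<subseteq> L i \<union> D"
      proof
        fix x assume "x \<in> C"
        then show "x \<in> L i \<union> D"
          using card_supp[of x] all_i[of x] Ccar(1)[of x]
          by (auto simp: D_def L_def card_1_singleton_iff)
      qed
      then have "card C \<le> card (L i) + card D"
        using card_mono[of "L i \<union> D" C] card_Un_le[of "L i" D] finL finC
        by (auto simp: D_def)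
      with \<open>card D \<le> 2\<close> leM[OF iI] show ?thesis by linarith
    next
      case False
      then have "D = C" using card_supp by (auto simp: D_def)
      then have "supp ` C \<subseteq> {A. A \<subseteq> I \<and> card A = 2}" "card (supp ` C) = card C"
        using Ccar card_image[OF inj] by (auto simp: D_def)
      then have "card C \<le> 3 choose 2"
        using card_mono[of "{A. A \<subseteq> I \<and> card A = 2}" "supp ` C"] finI I3
        by (simp add: n_subsets)
      also have "3 choose 2 = (3::nat)" by (simp add: numeral_eq_Suc)
      finally have "card C \<le> 3" .
      moreover obtain i where "i \<in> I" using neI by blast
      \<comment> \<open>Some element has support \<open>{i}\<close>, so \<open>M\<close> is at least
        1 and the bound 3 fits below \<open>M + 2\<close>.\<close>
      ultimately show ?thesis using leM[of i] Lpos[of i] by linarith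
    qed
  qed
  have "\<exists>C. C \<subseteq> V \<and> clique C E \<and> card C = M + 2"
  proof -
    have "M \<in> (\<lambda>i. card (L i)) ` I" unfolding M_def using finI neI by (intro Max_in) auto
    then obtain i where i: "i \<in> I" "card (L i) = M" by auto
    then have "card (I - {i}) = 2" using I3 by simp
    then obtain j k where jk: "I - {i} = {j, k}" "j \<noteq> k" by (auto simp: card_2_iff)
    then have I: "I = {i, j, k}" "i \<noteq> j" "i \<noteq> k" using i(1) by auto
    obtain u where u: "u \<in> carrier R" "supp u = {i, j}" using supp_onto[of "{i, j}"] I by auto
    obtain v where v: "v \<in> carrier R" "supp v = {i, k}" using supp_onto[of "{i, k}"] I by auto
    \<comment> \<open>The index \<open>i\<close> attains the maximum \<open>M\<close>. All supports
      in \<open>C\<close> contain \<open>i\<close>, hence meet, and each of the two two-element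
      supports through \<open>i\<close> is represented only once.\<close>
    define C where "C = insert u (insert v (L i))"
    have uv: "u \<noteq> v" "u \<notin> L i" "v \<notin> L i"
      using u v I jk(2) by (auto simp: L_def doubleton_eq_iff)
    have cardC: "card C = M + 2" unfolding C_def using uv finL i(2) by simp
    have Csupp: "x \<in> carrier R \<and> (supp x = {i} \<or> x = u \<or> x = v)" if "x \<in> C" for x
      using that u v by (auto simp: C_def L_def)
    have Cnz: "x \<in> nonzero_zero_divisors R \<and> i \<in> supp x" if "x \<in> C" for x
      using Csupp[OF that] u v I jk(2) by (auto simp: nonzero_zero_divisors_iff)
    have "{x, y} \<in> E" if xy: "x \<in> C" "y \<in> C" "x \<noteq> y" for x y
    proof -
      have "\<not> (supp x = supp y \<and> card (supp x) = 2)"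
        using Csupp[OF xy(1)] Csupp[OF xy(2)] u v I jk(2) xy(3)
        by (auto simp: doubleton_eq_iff)
      then show ?thesis using edge Cnz[OF xy(1)] Cnz[OF xy(2)] xy(3) by blast
    qed
    then have "clique C E" by (auto simp: clique_def)
    moreover from this have "C \<subseteq> V"
      unfolding V_def E_def by (rule clique_subset_difference_graph_verts) (simp add: cardC)
    ultimately show ?thesis using cardC by blast
  qed
  \<comment> \<open>Finiteness of the set of clique sizes is what lets the bound and the example
    determine its \<open>Max\<close>.\<close>
  moreover have "finite {card C | C. C \<subseteq> V \<and> clique C E}"
    by (rule finite_subset[of _ "card ` Pow V"]) (use finV in auto)
  ultimately have "Max {card C | C. C \<subseteq> V \<and> clique C E} = M + 2"
    using upper by (intro Max_eqI) (auto, metis)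
  then show ?thesis by (simp add: clique_number_def V_def E_def M_def L_def)
qed

end

section \<open>Products of three fields\<close>

lemma RDirProd_zero: "\<zero>\<^bsub>RDirProd R S\<^esub> = (\<zero>\<^bsub>R\<^esub>, \<zero>\<^bsub>S\<^esub>)"
  by (simp add: RDirProd_def DirProd_def monoid.defs)

lemma RDirProd_mult:
  "(a, b) \<otimes>\<^bsub>RDirProd R S\<^esub> (c, d) = (a \<otimes>\<^bsub>R\<^esub> c, b \<otimes>\<^bsub>S\<^esub> d)"
  by (simp add: RDirProd_def DirProd_def monoid.defs)

text \<open>Coordinates are recorded by their positions, since the three factors may have different
  types.\<close>

fun triple_support ::
  "('a, 'm) ring_scheme \<Rightarrow> ('b, 'n) ring_scheme \<Rightarrow> ('c, 'k) ring_scheme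
    \<Rightarrow> 'a \<times> 'b \<times> 'c \<Rightarrow> nat set" where
  "triple_support F1 F2 F3 (a, b, c) =
     (if a = \<zero>\<^bsub>F1\<^esub> then {} else {1}) \<union> (if b = \<zero>\<^bsub>F2\<^esub> then {} else {2}) \<union>
     (if c = \<zero>\<^bsub>F3\<^esub> then {} else {3})"

lemma triple_support_singleton_iff:
  "triple_support F1 F2 F3 (a, b, c) = {1} \<longleftrightarrow> a \<noteq> \<zero>\<^bsub>F1\<^esub> \<and> b = \<zero>\<^bsub>F2\<^esub> \<and> c = \<zero>\<^bsub>F3\<^esub>"
  "triple_support F1 F2 F3 (a, b, c) = {2} \<longleftrightarrow> a = \<zero>\<^bsub>F1\<^esub> \<and> b \<noteq> \<zero>\<^bsub>F2\<^esub> \<and> c = \<zero>\<^bsub>F3\<^esub>"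
  "triple_support F1 F2 F3 (a, b, c) = {3} \<longleftrightarrow> a = \<zero>\<^bsub>F1\<^esub> \<and> b = \<zero>\<^bsub>F2\<^esub> \<and> c \<noteq> \<zero>\<^bsub>F3\<^esub>"
  by (cases "a = \<zero>\<^bsub>F1\<^esub>"; cases "b = \<zero>\<^bsub>F2\<^esub>"; cases "c = \<zero>\<^bsub>F3\<^esub>"; simp add: set_eq_iff; presburger?)+

text \<open>Fields have no proper zero-divisors, so a product vanishes iff at each position one of
  the two coordinates does, that is, iff the supports are disjoint.\<close>

lemma ring_with_supports_triple_product:
  assumes "field F1" "field F2" "field F3"
  shows "ring_with_supports (RDirProd F1 (RDirProd F2 F3)) {1, 2, 3} (triple_support F1 F2 F3)"
proof -
  interpret F1: field F1 by fact
  interpret F2: field F2 by fact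
  interpret F3: field F3 by fact
  let ?R = "RDirProd F1 (RDirProd F2 F3)" and ?s = "triple_support F1 F2 F3"
  show ?thesis
  proof
    fix x assume "x \<in> carrier ?R"
    show "?s x \<subseteq> {1, 2, 3}" by (cases x) auto
    show "x = \<zero>\<^bsub>?R\<^esub> \<longleftrightarrow> ?s x = {}" by (cases x) (auto simp: RDirProd_zero)
  next
    fix x y assume "x \<in> carrier ?R" "y \<in> carrier ?R"
    then show "x \<otimes>\<^bsub>?R\<^esub> y = \<zero>\<^bsub>?R\<^esub> \<longleftrightarrow> ?s x \<inter> ?s y = {}"
      by (cases x; cases y)
        (auto simp: RDirProd_zero RDirProd_mult RDirProd_carrier
          F1.integral_iff F2.integral_iff F3.integral_iff)
  next
    fix A :: "nat set" assume A: "A \<subseteq> {1, 2, 3}"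
    \<comment> \<open>The indicator vector of \<open>A\<close>; its support is \<open>A\<close>
      because one differs from zero in each field.\<close>
    let ?x = "(if 1 \<in> A then \<one>\<^bsub>F1\<^esub> else \<zero>\<^bsub>F1\<^esub>, if 2 \<in> A then \<one>\<^bsub>F2\<^esub> else \<zero>\<^bsub>F2\<^esub>,
               if 3 \<in> A then \<one>\<^bsub>F3\<^esub> else \<zero>\<^bsub>F3\<^esub>)"
    have "?x \<in> carrier ?R" by (simp add: RDirProd_carrier)
    moreover have "?s ?x = A" using A by auto
    ultimately show "\<exists>x \<in> carrier ?R. ?s x = A" by blast
  qed
qed

theorem theorem4p4:
  fixes F1 :: "('a, 'm) ring_scheme" and F2 :: "('b, 'n) ring_scheme"
    and F3 :: "('c, 'k) ring_scheme" and R :: "('a \<times> 'b \<times> 'c) ring"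
    and q1 q2 q3 :: nat
  assumes "field F1" and "finite (carrier F1)" and "order F1 = q1"
    and "field F2" and "finite (carrier F2)" and "order F2 = q2"
    and "field F3" and "finite (carrier F3)" and "order F3 = q3"
    and "R = RDirProd F1 (RDirProd F2 F3)"
  shows "clique_number (difference_graph_verts R) (difference_graph_edges R)
           = Max {q1, q2, q3} + 1"
proof -
  interpret F1: field F1 by fact
  interpret F2: field F2 by fact
  interpret F3: field F3 by fact
  interpret ring_with_supports R "{1, 2, 3}" "triple_support F1 F2 F3"
    using ring_with_supports_triple_product assms by simp
  let ?L = "\<lambda>i. {x \<in> carrier R. triple_support F1 F2 F3 x = {i}}"
  have R: "carrier R = carrier F1 \<times> carrier F2 \<times> carrier F3"
    using assms by (simp add: RDirProd_carrier)
  have "?L 1 = (carrier F1 - {\<zero>\<^bsub>F1\<^esub>}) \<times> {\<zero>\<^bsub>F2\<^esub>} \<times> {\<zero>\<^bsub>F3\<^esub>}"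
    "?L 2 = {\<zero>\<^bsub>F1\<^esub>} \<times> (carrier F2 - {\<zero>\<^bsub>F2\<^esub>}) \<times> {\<zero>\<^bsub>F3\<^esub>}"
    "?L 3 = {\<zero>\<^bsub>F1\<^esub>} \<times> {\<zero>\<^bsub>F2\<^esub>} \<times> (carrier F3 - {\<zero>\<^bsub>F3\<^esub>})"
    unfolding R
    by - (rule Set.set_eqI, simp only: split_paired_all mem_Collect_eq mem_Sigma_iff
        Diff_iff singleton_iff triple_support_singleton_iff, fastforce)+
  then have cards: "card (?L 1) = q1 - 1" "card (?L 2) = q2 - 1" "card (?L 3) = q3 - 1"
    using assms by (simp_all add: card_cartesian_product order_def)
  \<comment> \<open>Subtraction on \<open>nat\<close> truncates: positivity is needed to rewrite
    each \<open>q - 1 + 2\<close> as \<open>q + 1\<close>.\<close>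
  have "q1 > 0" "q2 > 0" "q3 > 0"
    using assms by (metis F1.carrier_not_empty F2.carrier_not_empty F3.carrier_not_empty
        card_gt_0_iff order_def)+
  moreover have "finite (carrier R)" using R assms by simp
  then have "clique_number (difference_graph_verts R) (difference_graph_edges R)
      = Max (card ` ?L ` {1, 2, 3}) + 2"
    using clique_number_three by (simp add: image_image)
  ultimately show ?thesis by (simp only: image_insert image_empty cards) (auto simp: max_def)
qed

end
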